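(* Let $1<p<2$, $0\le\beta_p\le p-1$, $\ell\ge0$, $\xi_1\ge1$, $\xi_2>0$, and put $\varphi(t):=\max\{\ell,t\}$ and $m_\xi:=\min\{\xi_1,\xi_2\}$. Let $\mathtt F_p:[0,\infty)^3\to\mathbb R$ satisfy: (a) there is $\theta\in(0,1]$ with $\mathtt F_p\in C^{0,\theta}_{\mathrm{loc}}([0,\infty)^3)$, and $\mathtt F_p(t,u,s)\ge0$; (b) for every $t\ge0$, $u\mapsto\mathtt F_p(t,u,s)$ is nondecreasing on $[1,\xi_1(1+\varphi(t))]$ for every $s\in[0,\xi_2]$, and $s\mapsto\mathtt F_p(t,u,s)$ is nondecreasing on $[0,\xi_2]$ for every $u\in[1,\xi_1(1+\varphi(t))]$; (c) $\int_0^\infty\mathtt F_p(t,\xi_1(1+\varphi(t)),\xi_2)\,dt\le m_\xi^{p-1}$. Then the equation $$\frac{d}{dx}\left(|u'(x)|^{p-2}u'(x)\right)=\mathtt F_p(|x|,u(x),|u'(x)|)\,u(x)^{-\beta_p},\qquad x\in\mathbb R,$$ has at least one even positive entire solution $u_p(x)=y_p(|x|)$. It satisfies $$1\le y_p(t)\le\xi_1(1+\varphi(t)),\qquad 0\le y_p'(t)\le\xi_2,\qquad t\ge0,$$ and $y_p(0)=1$, $y_p'(0)=0$. Moreover, if $\mathtt F_p(r_0,1,0)\ne0$ for some $r_0\in[0,\infty)$, then $$\lim_{t\to\infty}\frac{y_p(t)}{\varphi(t)}=C_p,\qquad\text{where}\qquad C_p=\left[\int_0^\infty\mathtt F_p(t,y_p(t),y_p'(t))\,y_p(t)^{-\beta_p}\,dt\right]^{\frac1{p-1}},$$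 and $0<C_p\le m_\xi$.
   Context: An entire solution is understood classically: $u\in C^1(\mathbb R)$ with $|u'|^{p-2}u'\in C^1(\mathbb R)$ (where $|0|^{p-2}0:=0$) and the equation holds for every $x\in\mathbb R$. $C^{0,\theta}_{\mathrm{loc}}$ means $\theta$-Hölder continuous on compact subsets. *)

theory Defs
  imports "HOL-Analysis.Analysis"
begin

definition locally_holder_on ::
    "real \<Rightarrow> 'a::metric_space set \<Rightarrow> ('a \<Rightarrow> 'b::metric_space) \<Rightarrow> bool" where
  "locally_holder_on \<theta> S f \<longleftrightarrow>
     (\<forall>K. compact K \<and> K \<subseteq> S \<longrightarrow>
        (\<exists>C. \<forall>x\<in>K. \<forall>y\<in>K. dist (f x) (f y) \<le> C * dist x y powr \<theta>))"

(* The convention 0 powr a = 0 matches |0|^(p-2) 0 := 0. *)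
definition p_flux :: "real \<Rightarrow> (real \<Rightarrow> real) \<Rightarrow> real \<Rightarrow> real" where
  "p_flux p u x = \<bar>deriv u x\<bar> powr (p - 2) * deriv u x"

(* Classical solution on the whole line of (|u'|^(p-2) u')' = F(|x|, u, |u'|) u^(-beta).
   Only meaningful for positive u: F is a function on [0,oo)^3, represented by a total
   function whose values elsewhere are irrelevant. *)
definition entire_solution ::
    "real \<Rightarrow> real \<Rightarrow> (real \<times> real \<times> real \<Rightarrow> real) \<Rightarrow> (real \<Rightarrow> real) \<Rightarrow> bool" where
  "entire_solution p \<beta> F u \<longleftrightarrow>
     u C1_differentiable_on UNIV \<and>
     p_flux p u C1_differentiable_on UNIV \<and>
     (\<forall>x. deriv (p_flux p u) x = F (\<bar>x\<bar>, u x, \<bar>deriv u x\<bar>) * u x powr (-\<beta>))"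

end

theory Submission
  imports Defs "HOL-Complex_Analysis.Great_Picard"
begin

text \<open>The flux w = |y'|^(p-2) y' turns the equation into a first-order system for (y, w) on the
  half line with a merely continuous right-hand side, so existence is Peano's theorem. The
  monotonicity of F and the integral bound confine w to [0, m^(p-1)], hence y' to [0, m], which is
  exactly the region where the bound on F holds. Since y'(0) = 0, the even extension of y has the
  odd extension of w as its flux. Finally w increases to the integral of the right-hand side, and
  l'Hospital's rule turns the limit of y' into that of y(t)/t.\<close>

section \<open>Integrals over \<open>{0..t}\<close> as functions of \<open>t\<close>\<close>

lemma integral_has_vector_derivative_half_line:
  fixes g :: "real \<Rightarrow> 'a::banach"
  assumes "continuous_on {0..} g" and "0 \<le> t"
  shows "((\<lambda>t. integral {0..t} g) has_vector_derivative g t) (at t within {0..})"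
proof -
  have "((\<lambda>t. integral {0..t} g) has_vector_derivative g t) (at t within {0..t+1})"
    using assms by (intro integral_has_vector_derivative) (auto intro: continuous_on_subset)
  moreover have "at t within {0..t+1} = at t within {0..}"
    using assms by (intro at_within_nhd[where S="{..<t+1}"]) auto
  ultimately show ?thesis by simp
qed

text \<open>For negative \<open>t\<close> the interval \<open>{0..t}\<close> is empty and the
  integral is 0, so \<open>t\<close> may be replaced by \<open>max 0 t\<close>. Continuity on the
  whole line is wanted because delayed times \<open>s - \<delta>\<close> can be negative.\<close>

lemma continuous_on_integral_half_line:
  fixes g :: "real \<Rightarrow> 'a::banach"
  assumes "continuous_on {0..} g"
  shows "continuous_on UNIV (\<lambda>t. integral {0..t} g)"
proof -
  have "continuous_on {0..} (\<lambda>t. integral {0..t} g)"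
    using integral_has_vector_derivative_half_line[OF assms]
    by (meson atLeast_iff continuous_on_eq_continuous_within has_vector_derivative_continuous)
  then have "continuous_on UNIV (\<lambda>t. integral {0..max 0 t} g)"
    by (rule continuous_on_compose2[where f="\<lambda>t. max 0 t"]) (auto intro!: continuous_intros)
  moreover have "integral {0..max 0 t} g = integral {0..t} g" for t
    by (cases "t \<le> 0") (auto simp: max_def not_le)
  ultimately show ?thesis by simp
qed

text \<open>This turns a bound depending on time alone into a modulus of continuity that all
  approximate solutions share. Leaving \<open>s\<close> and \<open>t\<close> unordered and of any
  sign spares later case distinctions.\<close>

lemma norm_integral_diff_le:
  fixes g :: "real \<Rightarrow> 'a::euclidean_space"
  assumes g: "continuous_on {0..} g" and h: "continuous_on {0..} h"
    and le: "\<And>t. 0 \<le> t \<Longrightarrow> norm (g t) \<le> h t"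
  shows "norm (integral {0..t} g - integral {0..s} g) \<le> \<bar>integral {0..t} h - integral {0..s} h\<bar>"
proof -
  have *: "norm (integral {0..t} g - integral {0..s} g) \<le> \<bar>integral {0..t} h - integral {0..s} h\<bar>"
    if st: "0 \<le> s" "s \<le> t" for s t
  proof -
    have gi: "g integrable_on {a..t}" if "0 \<le> a" for a
      using that by (intro integrable_continuous_real continuous_on_subset[OF g]) auto
    have hi: "h integrable_on {a..t}" if "0 \<le> a" for a
      using that by (intro integrable_continuous_real continuous_on_subset[OF h]) auto
    have "integral {0..t} g - integral {0..s} g = integral {s..t} g"
      using Henstock_Kurzweil_Integration.integral_combine[OF st gi[of 0]] by (simp add: algebra_simps)
    moreover have "integral {0..t} h - integral {0..s} h = integral {s..t} h"
      using Henstock_Kurzweil_Integration.integral_combine[OF st hi[of 0]] by (simp add: algebra_simps)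
    moreover have "norm (integral {s..t} g) \<le> integral {s..t} h"
      using st by (intro integral_norm_bound_integral gi hi le) auto
    ultimately show ?thesis by simp
  qed
  \<comment> \<open>Negative endpoints give integrals over the empty set, so the ordered case
    applies to the positive parts of \<open>s\<close> and \<open>t\<close>.\<close>
  have max0: "integral {0..r} k = integral {0..max 0 r} k" for k :: "real \<Rightarrow> 'b::banach" and r
    by (cases "r \<le> 0") (auto simp: max_def not_le)
  show ?thesis
    using *[of "max 0 s" "max 0 t"] *[of "max 0 t" "max 0 s"]
    unfolding max0[of t] max0[of s] norm_minus_commute[of "integral {0..max 0 t} g"]
      abs_minus_commute[of "integral {0..max 0 t} h"]
    by (cases "s \<le> t") (simp_all add: max_def norm_minus_commute)
qed

section \<open>Peano's existence theorem from equicontinuous approximations\<close>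

lemma continuous_on_UNIV_modulus:
  fixes v :: "real \<Rightarrow> 'a::real_normed_vector" and B :: "real \<Rightarrow> real"
  assumes B: "continuous_on UNIV B" and v: "\<And>s t. norm (v t - v s) \<le> \<bar>B t - B s\<bar>"
  shows "continuous_on UNIV v"
  unfolding continuous_on_def
proof
  fix t
  have "B \<midarrow>t\<rightarrow> B t" using B by (simp add: continuous_on_def)
  then have "(\<lambda>s. \<bar>B s - B t\<bar>) \<midarrow>t\<rightarrow> 0" by (intro tendsto_rabs_zero LIM_zero)
  then have "(\<lambda>s. v s - v t) \<midarrow>t\<rightarrow> 0"
    by (rule Lim_null_comparison[rotated]) (intro always_eventually allI v)
  then show "v \<midarrow>t\<rightarrow> v t" by (rule LIM_zero_cancel)
qed

lemma continuous_on_half_line_Pair: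
  fixes f :: "real \<times> 'a::topological_space \<Rightarrow> 'b::topological_space"
  assumes "continuous_on ({0..} \<times> UNIV) f" and "continuous_on {0..} v"
  shows "continuous_on {0..} (\<lambda>s. f (s, v s))"
  using continuous_on_compose2[OF assms(1) continuous_on_Pair[OF continuous_on_id assms(2)]] by auto

text \<open>A common modulus of continuity B replaces uniform convergence: pointwise convergence on the
  rationals already determines the limit.\<close>
lemma equicontinuous_pointwise_subsequence:
  fixes u :: "nat \<Rightarrow> real \<Rightarrow> 'a::euclidean_space"
  assumes B: "continuous_on UNIV B"
    and u: "\<And>n s t. norm (u n t - u n s) \<le> \<bar>B t - B s\<bar>"
    and u0: "\<And>n. u n 0 = x0"
  obtains k x where "strict_mono (k::nat \<Rightarrow> nat)" "\<And>t. (\<lambda>n. u (k n) t) \<longlonglongrightarrow> x t"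
proof -
  \<comment> \<open>The diagonal argument asks for one bound valid at all rationals, but the values
    may grow with \<open>q\<close>. Dividing by \<open>c q\<close> brings them into the unit ball;
    the summand 1 keeps \<open>c q\<close> positive.\<close>
  define c where "c q = 1 + norm x0 + \<bar>B q - B 0\<bar>" for q
  have cpos: "c q > 0" for q by (simp add: c_def add_pos_nonneg)
  have bd: "norm (u n q) \<le> c q" for n q
    using u[of n q 0] norm_triangle_sub[of "u n q" x0] u0[of n] unfolding c_def by simp
  have "norm ((1 / c q) *\<^sub>R u n q) \<le> 1" for n q
    using bd[of n q] cpos[of q] by (simp add: field_simps)
  then obtain k where k: "strict_mono (k::nat \<Rightarrow> nat)"
    and lim: "\<And>q. q \<in> \<rat> \<Longrightarrow> \<exists>l. (\<lambda>n. (1 / c q) *\<^sub>R u (k n) q) \<longlonglongrightarrow> l"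
    using function_convergent_subsequence[OF countable_rat, of "\<lambda>n q. (1 / c q) *\<^sub>R u n q" 1]
    by blast
  have limQ: "Cauchy (\<lambda>n. u (k n) q)" if q: "q \<in> \<rat>" for q
  proof -
    obtain l where "(\<lambda>n. (1 / c q) *\<^sub>R u (k n) q) \<longlonglongrightarrow> l" using lim[OF q] by blast
    from tendsto_scaleR[OF tendsto_const[of "c q"] this]
    have "(\<lambda>n. u (k n) q) \<longlonglongrightarrow> c q *\<^sub>R l" using cpos[of q] by (simp add: less_imp_neq[symmetric])
    then show ?thesis by (rule LIMSEQ_imp_Cauchy)
  qed
  have "Cauchy (\<lambda>n. u (k n) t)" for t
  proof (rule metric_CauchyI)
    fix e :: real assume e: "0 < e"
    have "isCont B t" using B by (simp add: continuous_on_eq_continuous_at)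
    then obtain d where d: "d > 0" "\<And>s. dist s t < d \<Longrightarrow> dist (B s) (B t) < e/3"
      using e unfolding continuous_at_eps_delta by (metis zero_less_divide_iff zero_less_numeral)
    \<comment> \<open>Splitting into thirds: near \<open>t\<close> the modulus \<open>B\<close>
      controls both outer differences uniformly in the index, and convergence at the rational
      \<open>q\<close> controls the middle one.\<close>
    obtain q where q: "q \<in> \<rat>" "t < q" "q < t + d" using Rats_dense_in_real[of t "t+d"] d by auto
    have Bq: "\<bar>B t - B q\<bar> < e/3" using d(2)[of q] q by (simp add: dist_real_def abs_minus_commute)
    obtain N where N: "\<And>m n. m \<ge> N \<Longrightarrow> n \<ge> N \<Longrightarrow> dist (u (k m) q) (u (k n) q) < e/3"
      using metric_CauchyD[OF limQ[OF q(1)], of "e/3"] e by auto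
    have "dist (u (k m) t) (u (k n) t) < e" if "m \<ge> N" "n \<ge> N" for m n
    proof -
      have "dist (u (k m) t) (u (k n) t) \<le>
          dist (u (k m) t) (u (k m) q) + dist (u (k m) q) (u (k n) q) + dist (u (k n) q) (u (k n) t)"
        by metric
      then show ?thesis
        using u[of "k m" t q] u[of "k n" t q] Bq N[OF that] by (simp add: dist_norm norm_minus_commute)
    qed
    then show "\<exists>N. \<forall>m\<ge>N. \<forall>n\<ge>N. dist (u (k m) t) (u (k n) t) < e" by blast
  qed
  then have "\<And>t. convergent (\<lambda>n. u (k n) t)" by (simp add: Cauchy_convergent)
  then have "\<And>t. (\<lambda>n. u (k n) t) \<longlonglongrightarrow> lim (\<lambda>n. u (k n) t)" by (simp add: convergent_LIMSEQ_iff)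
  with k show thesis by (rule that)
qed

text \<open>Tonelli's scheme: evaluating f at a delayed time makes the integral equation solvable by
  finitely many iterations on each bounded interval.\<close>
lemma delayed_integral_equation:
  fixes f :: "real \<times> 'a::euclidean_space \<Rightarrow> 'a"
  assumes f: "continuous_on ({0..} \<times> UNIV) f" and h: "continuous_on {0..} h"
    and le: "\<And>t x. 0 \<le> t \<Longrightarrow> norm (f (t, x)) \<le> h t"
    and "0 < \<delta>"
  obtains u where "u 0 = x0"
    "\<And>s t. norm (u t - u s) \<le> \<bar>integral {0..t} h - integral {0..s} h\<bar>"
    "\<And>t. t \<le> real N * \<delta> \<Longrightarrow> u t = x0 + integral {0..t} (\<lambda>s. f (s, u (s - \<delta>)))"
proof -
  define B where "B t = integral {0..t} h" for t
  \<comment> \<open>The Picard operator with delay: on times up to \<open>t\<close>, the value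
    \<open>A u t\<close> sees \<open>u\<close> only up to \<open>t - \<delta>\<close>.\<close>
  define A where "A u t = x0 + integral {0..t} (\<lambda>s. f (s, u (s - \<delta>)))" for u t
  define X where "X k = (A ^^ k) (\<lambda>_. x0)" for k :: nat
  have XSuc: "X (Suc k) = A (X k)" for k by (simp add: X_def)
  have Bcont: "continuous_on UNIV B"
    unfolding B_def by (rule continuous_on_integral_half_line[OF h])
  have P: "norm (X k t - X k s) \<le> \<bar>B t - B s\<bar>" for k s t
  proof (induction k arbitrary: s t)
    case 0 show ?case by (simp add: X_def)
  next
    case (Suc k)
    \<comment> \<open>The modulus from the induction hypothesis gives continuity of
      \<open>X k\<close>, hence of the next integrand; the bound by \<open>h\<close> then renews the
      same modulus.\<close>
    have "continuous_on UNIV (X k)"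
      by (rule continuous_on_UNIV_modulus[OF Bcont Suc.IH])
    then have "continuous_on {0..} (\<lambda>s. X k (s - \<delta>))"
      by (rule continuous_on_compose2) (auto intro!: continuous_intros)
    then have "continuous_on {0..} (\<lambda>s. f (s, X k (s - \<delta>)))"
      by (rule continuous_on_half_line_Pair[OF f])
    from norm_integral_diff_le[OF this h le]
    show ?case unfolding XSuc A_def B_def by simp
  qed
  have X0: "X k t = x0" if "t \<le> 0" for k t
  proof (cases k)
    case 0 then show ?thesis by (simp add: X_def)
  next
    case (Suc j)
    have "integral {0..t} g = 0" for g :: "real \<Rightarrow> 'a" using that by (cases "t = 0") auto
    then show ?thesis by (simp add: Suc XSuc A_def)
  qed
  \<comment> \<open>Each iteration settles one more interval of length \<open>\<delta>\<close>: for
    \<open>s\<close> up to \<open>(k + 1) * \<delta>\<close> the integrand looks back to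
    \<open>s - \<delta>\<close>, at most \<open>k * \<delta>\<close>, where two successive iterates
    already agree.\<close>
  have fix_X: "X (Suc k) t = X k t" if "t \<le> real k * \<delta>" for k t
    using that
  proof (induction k arbitrary: t)
    case 0 then show ?case using X0[of t] by simp
  next
    case (Suc k)
    have "integral {0..t} (\<lambda>s. f (s, X (Suc k) (s - \<delta>))) = integral {0..t} (\<lambda>s. f (s, X k (s - \<delta>)))"
      using Suc.prems by (intro integral_cong arg_cong[where f=f]) (auto simp: algebra_simps intro!: Suc.IH)
    then show ?case by (simp add: XSuc[of "Suc k"] XSuc[of k] A_def)
  qed
  show thesis
  proof (rule that[of "X N"])
    show "X N 0 = x0" by (simp add: X0)
    show "norm (X N t - X N s) \<le> \<bar>integral {0..t} h - integral {0..s} h\<bar>" for s t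
      using P[of N t s] by (simp add: B_def)
    show "X N t = x0 + integral {0..t} (\<lambda>s. f (s, X N (s - \<delta>)))" if "t \<le> real N * \<delta>" for t
      using fix_X[OF that] by (simp add: XSuc A_def)
  qed
qed

text \<open>Since \<open>h\<close> does not depend on the state, no blow-up occurs and the solution
  is global. Delayed solutions with delay tending to 0 have a pointwise convergent subsequence, and
  dominated convergence with majorant \<open>h\<close> carries the integral equation to the
  limit.\<close>

theorem Peano_half_line:
  fixes f :: "real \<times> 'a::euclidean_space \<Rightarrow> 'a"
  assumes f: "continuous_on ({0..} \<times> UNIV) f" and h: "continuous_on {0..} h"
    and le: "\<And>t x. 0 \<le> t \<Longrightarrow> norm (f (t, x)) \<le> h t"
  obtains x where "x 0 = x0"
    "\<And>t. 0 \<le> t \<Longrightarrow> (x has_vector_derivative f (t, x t)) (at t within {0..})"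
proof -
  define B where "B t = integral {0..t} h" for t
  have Bcont: "continuous_on UNIV B"
    unfolding B_def by (rule continuous_on_integral_half_line[OF h])
  define \<delta> where "\<delta> n = inverse (real (Suc n))" for n
  have "\<exists>u. u 0 = x0 \<and> (\<forall>s t. norm (u t - u s) \<le> \<bar>B t - B s\<bar>) \<and>
      (\<forall>t\<le>real (Suc n). u t = x0 + integral {0..t} (\<lambda>s. f (s, u (s - \<delta> n))))" for n
  proof -
    have pos: "0 < \<delta> n" by (simp add: \<delta>_def)
    \<comment> \<open>With delay \<open>1 / (n + 1)\<close>, taking \<open>(n + 1)^2\<close>
      iterations reaches time \<open>n + 1\<close>: the horizon grows while the delay
      shrinks.\<close>
    have N: "real (Suc n * Suc n) * \<delta> n = real (Suc n)"
      unfolding \<delta>_def of_nat_mult by simp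
    obtain u where "u 0 = x0" "\<And>s t. norm (u t - u s) \<le> \<bar>B t - B s\<bar>"
      "\<And>t. t \<le> real (Suc n) \<Longrightarrow> u t = x0 + integral {0..t} (\<lambda>s. f (s, u (s - \<delta> n)))"
      by (rule delayed_integral_equation
            [OF f h le pos, where N="Suc n * Suc n" and ?x0.0=x0, unfolded N, folded B_def]) (assumption, rule that)
    then show ?thesis by (intro exI[of _ u]) auto
  qed
  then obtain u where u: "\<And>n. u n 0 = x0 \<and> (\<forall>s t. norm (u n t - u n s) \<le> \<bar>B t - B s\<bar>) \<and>
      (\<forall>t\<le>real (Suc n). u n t = x0 + integral {0..t} (\<lambda>s. f (s, u n (s - \<delta> n))))"
    using choice[of "\<lambda>n u. u 0 = x0 \<and> (\<forall>s t. norm (u t - u s) \<le> \<bar>B t - B s\<bar>) \<and>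
      (\<forall>t\<le>real (Suc n). u t = x0 + integral {0..t} (\<lambda>s. f (s, u (s - \<delta> n))))"] by blast
  have u0: "\<And>n. u n 0 = x0" and uB: "\<And>n s t. norm (u n t - u n s) \<le> \<bar>B t - B s\<bar>"
    and ueq: "\<And>n t. t \<le> real (Suc n) \<Longrightarrow> u n t = x0 + integral {0..t} (\<lambda>s. f (s, u n (s - \<delta> n)))"
    using u by (blast, blast, blast)
  obtain k x where k: "strict_mono (k::nat \<Rightarrow> nat)" and lim: "\<And>t. (\<lambda>n. u (k n) t) \<longlonglongrightarrow> x t"
    by (rule equicontinuous_pointwise_subsequence[OF Bcont uB u0]) (rule that)
  have xB: "norm (x t - x s) \<le> \<bar>B t - B s\<bar>" for s t
    by (rule LIMSEQ_le_const2[OF tendsto_norm[OF tendsto_diff[OF lim lim]]]) (use uB in blast)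
  have \<delta>0: "\<delta> \<longlonglongrightarrow> 0" unfolding \<delta>_def by (rule LIMSEQ_inverse_real_of_nat)
  then have \<delta>k: "(\<lambda>n. \<delta> (k n)) \<longlonglongrightarrow> 0" using LIMSEQ_subseq_LIMSEQ[OF \<delta>0 k] by (simp add: o_def)
  \<comment> \<open>The vanishing delay does not change the limit: the common modulus bounds the
    effect of the shift by the increment of \<open>B\<close>, uniformly in the index.\<close>
  have limd: "(\<lambda>n. u (k n) (s - \<delta> (k n))) \<longlonglongrightarrow> x s" for s
  proof -
    have "(\<lambda>n. s - \<delta> (k n)) \<longlonglongrightarrow> s" using tendsto_diff[OF tendsto_const \<delta>k, of s] by simp
    then have "(\<lambda>n. B (s - \<delta> (k n))) \<longlonglongrightarrow> B s"
      using Bcont by (intro isCont_tendsto_compose[where g=B]) (simp_all add: continuous_on_eq_continuous_at)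
    then have "(\<lambda>n. \<bar>B (s - \<delta> (k n)) - B s\<bar>) \<longlonglongrightarrow> 0" by (intro tendsto_rabs_zero LIM_zero)
    then have "(\<lambda>n. u (k n) (s - \<delta> (k n)) - u (k n) s) \<longlonglongrightarrow> 0"
      by (rule Lim_null_comparison[rotated]) (use uB in auto)
    from tendsto_add[OF this lim[of s]] show ?thesis by simp
  qed
  have xeq: "x t = x0 + integral {0..t} (\<lambda>s. f (s, x s))" if "0 \<le> t" for t
  proof -
    have "(\<lambda>n. integral {0..t} (\<lambda>s. f (s, u (k n) (s - \<delta> (k n))))) \<longlonglongrightarrow> integral {0..t} (\<lambda>s. f (s, x s))"
    proof (rule dominated_convergence)
      show "(\<lambda>s. f (s, u (k n) (s - \<delta> (k n)))) integrable_on {0..t}" for n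
      proof -
        have "continuous_on {0..} (\<lambda>s. u (k n) (s - \<delta> (k n)))"
          by (rule continuous_on_compose2[OF continuous_on_UNIV_modulus[OF Bcont uB]])
             (auto intro!: continuous_intros)
        from continuous_on_half_line_Pair[OF f this] show ?thesis
          by (intro integrable_continuous_real) (auto elim: continuous_on_subset)
      qed
      show "h integrable_on {0..t}"
        by (intro integrable_continuous_real continuous_on_subset[OF h]) auto
      show "(\<lambda>n. f (s, u (k n) (s - \<delta> (k n)))) \<longlonglongrightarrow> f (s, x s)" if "s \<in> {0..t}" for s
        by (rule continuous_on_tendsto_compose[OF f])
           (use that in \<open>auto intro!: tendsto_Pair limd\<close>)
    qed (auto intro: le)
    from tendsto_add[OF tendsto_const this, of x0]
    have "(\<lambda>n. u (k n) t) \<longlonglongrightarrow> x0 + integral {0..t} (\<lambda>s. f (s, x s))"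
    proof (rule Lim_transform_eventually)
      \<comment> \<open>The \<open>n\<close>-th approximation solves its equation only up to time
        \<open>n + 1\<close>; as \<open>k n\<close> is at least \<open>n\<close>, a fixed
        \<open>t\<close> is eventually covered.\<close>
      obtain n0 where n0: "t \<le> real n0" using real_arch_simple by blast
      show "\<forall>\<^sub>F n in sequentially. x0 + integral {0..t} (\<lambda>s. f (s, u (k n) (s - \<delta> (k n)))) = u (k n) t"
        unfolding eventually_sequentially
      proof (intro exI allI impI)
        fix n assume "n0 \<le> n"
        with seq_suble[OF k, of n] have "t \<le> real (Suc (k n))" using n0 by linarith
        from ueq[OF this] show "x0 + integral {0..t} (\<lambda>s. f (s, u (k n) (s - \<delta> (k n)))) = u (k n) t" by simp
      qed
    qed
    then show ?thesis using lim LIMSEQ_unique by blast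
  qed
  have fx: "continuous_on {0..} (\<lambda>s. f (s, x s))"
    by (intro continuous_on_half_line_Pair[OF f]
          continuous_on_subset[OF continuous_on_UNIV_modulus[OF Bcont xB]]) auto
  show thesis
  proof (rule that)
    show "x 0 = x0" using xeq[of 0] by simp
    fix t :: real assume t: "0 \<le> t"
    have "((\<lambda>t. x0 + integral {0..t} (\<lambda>s. f (s, x s))) has_vector_derivative 0 + f (t, x t)) (at t within {0..})"
      by (intro has_vector_derivative_add has_vector_derivative_const
            integral_has_vector_derivative_half_line[OF fx t])
    then show "(x has_vector_derivative f (t, x t)) (at t within {0..})"
      using t xeq by (subst has_vector_derivative_cong_ev) (auto simp: xeq)
  qed
qed

section \<open>Half-line calculus, Hoelder continuity and reflection\<close>

lemma fundamental_theorem_of_calculus_half_line: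
  fixes f f' :: "real \<Rightarrow> real"
  assumes "\<And>t. 0 \<le> t \<Longrightarrow> (f has_real_derivative f' t) (at t within {0..})" and "0 \<le> t"
  shows "(f' has_integral f t - f 0) {0..t}"
proof (rule fundamental_theorem_of_calculus[OF \<open>0 \<le> t\<close>])
  fix s assume "s \<in> {0..t}"
  then have "(f has_real_derivative f' s) (at s within {0..t})"
    by (intro DERIV_subset[OF assms(1)]) auto
  then show "(f has_vector_derivative f' s) (at s within {0..t})"
    by (simp add: has_real_derivative_iff_has_vector_derivative)
qed

text \<open>Around each point the unit ball cut with the closed set \<open>S\<close> is compact, and
  a Hoelder estimate there squeezes the distance to 0. This provides the continuity that Peano's
  theorem requires.\<close>

lemma locally_holder_on_imp_continuous_on:
  fixes f :: "'a::heine_borel \<Rightarrow> 'b::metric_space"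
  assumes "closed S" and "0 < \<theta>" and f: "locally_holder_on \<theta> S f"
  shows "continuous_on S f"
  unfolding continuous_on_def
proof
  fix x assume x: "x \<in> S"
  have "compact (cball x 1 \<inter> S)" using \<open>closed S\<close> by (simp add: compact_Int_closed)
  then obtain C where C: "\<And>y z. y \<in> cball x 1 \<inter> S \<Longrightarrow> z \<in> cball x 1 \<inter> S \<Longrightarrow>
      dist (f y) (f z) \<le> C * dist y z powr \<theta>"
    using f unfolding locally_holder_on_def by (meson Int_lower2)
  have "((\<lambda>y. C * dist y x powr \<theta>) \<longlongrightarrow> C * dist x x powr \<theta>) (at x within S)"
    using \<open>0 < \<theta>\<close> by (intro tendsto_intros) auto
  then have "((\<lambda>y. C * dist y x powr \<theta>) \<longlongrightarrow> 0) (at x within S)" by simp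
  moreover have "\<forall>\<^sub>F y in at x within S. norm (dist (f y) (f x)) \<le> C * dist y x powr \<theta>"
    unfolding eventually_at using x
    by (intro exI[of _ 1]) (auto intro!: C simp: dist_commute)
  ultimately have "((\<lambda>y. dist (f y) (f x)) \<longlongrightarrow> 0) (at x within S)"
    by (rule Lim_null_comparison[rotated])
  then show "(f \<longlongrightarrow> f x) (at x within S)" by (rule tendsto_dist_iff[THEN iffD2])
qed

text \<open>The case \<open>c = 1\<close> is the even extension and \<open>c = -1\<close> the odd
  one. The condition on \<open>f' 0\<close> makes the one-sided derivatives at 0 match: it says
  \<open>f' 0 = 0\<close> in the even case and holds automatically in the odd case.\<close>

lemma has_real_derivative_reflection:
  fixes f f' g :: "real \<Rightarrow> real"
  assumes der: "\<And>t. 0 \<le> t \<Longrightarrow> (f has_real_derivative f' t) (at t within {0..})"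
    and f'0: "f' 0 = - c * f' 0"
    and pos: "\<And>x. 0 \<le> x \<Longrightarrow> g x = f x" and neg: "\<And>x. x \<le> 0 \<Longrightarrow> g x = c * f (- x)"
  shows "(g has_real_derivative (if 0 \<le> x then f' x else - c * f' (- x))) (at x)"
proof -
  have R: "(g has_real_derivative f' x) (at x within {0..})" if "0 \<le> x" for x
    using der[OF that] by (rule has_field_derivative_transform_within[OF _ zero_less_one]) (use that pos in auto)
  have L: "(g has_real_derivative - c * f' (- x)) (at x within {..0})" if "x \<le> 0" for x
  proof -
    have "(f has_real_derivative f' (- x)) (at (- x) within uminus ` {..0})"
      using der[of "- x"] that by simp
    moreover have "(uminus has_real_derivative - 1) (at x within {..0})"
      by (auto intro!: derivative_eq_intros)
    ultimately have "((\<lambda>x. f (- x)) has_real_derivative - f' (- x)) (at x within {..0})"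
      using DERIV_image_chain[of f "f' (- x)" uminus x "{..0}" "-1"] by (simp add: o_def)
    then have "((\<lambda>x. c * f (- x)) has_real_derivative - c * f' (- x)) (at x within {..0})"
      by (auto dest: DERIV_cmult[where c=c])
    then show ?thesis by (rule has_field_derivative_transform_within[OF _ zero_less_one]) (use that neg in auto)
  qed
  consider "x > 0" | "x = 0" | "x < 0" by linarith
  then show ?thesis
  proof cases
    case 1
    then have "at x within {0..} = at x" by (intro at_within_interior) auto
    with R[of x] 1 show ?thesis by simp
  next
    case 2
    then have "(g has_real_derivative f' 0) (at 0 within {0..} \<union> {..0})"
      using R[of 0] L[of 0] f'0 unfolding has_field_derivative_iff Lim_within_Un by simp
    moreover have "{0..} \<union> {..0} = (UNIV :: real set)" by auto
    ultimately show ?thesis using 2 by simp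
  next
    case 3
    then have "at x within {..0} = at x" by (intro at_within_interior) auto
    with L[of x] 3 show ?thesis by simp
  qed
qed

section \<open>The clamped first-order system for \<open>y\<close> and its flux\<close>

text \<open>The equation is a first-order system for y and its flux w. Clamping the arguments of F to the
  region where F is controlled makes the right-hand side bounded; the resulting solution never
  leaves that region, so the clamps are invisible.\<close>
lemma flux_system_solution:
  fixes F :: "real \<times> real \<times> real \<Rightarrow> real" and b :: "real \<Rightarrow> real" and q \<beta> m \<xi> :: real
  assumes q: "0 < q" and \<beta>: "0 \<le> \<beta>" and m: "0 < m" "m \<le> \<xi>"
    and Fc: "continuous_on ({0..} \<times> {0..} \<times> {0..}) F"
    and F0: "\<And>t u s. 0 \<le> t \<Longrightarrow> 0 \<le> u \<Longrightarrow> 0 \<le> s \<Longrightarrow> 0 \<le> F (t, u, s)"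
    and bc: "continuous_on {0..} b" and b: "\<And>t. 0 \<le> t \<Longrightarrow> 1 + m * t \<le> b t"
    and le: "\<And>t u s. 0 \<le> t \<Longrightarrow> 1 \<le> u \<Longrightarrow> u \<le> b t \<Longrightarrow> 0 \<le> s \<Longrightarrow> s \<le> \<xi> \<Longrightarrow>
          F (t, u, s) \<le> F (t, b t, \<xi>)"
    and int: "set_integrable lborel {0..} (\<lambda>t. F (t, b t, \<xi>))"
      "(LBINT t:{0..}. F (t, b t, \<xi>)) \<le> m powr (1 / q)"
  obtains y w where "y 0 = 1" "w 0 = 0"
    "\<And>t. 0 \<le> t \<Longrightarrow> 1 \<le> y t \<and> y t \<le> 1 + m * t"
    "\<And>t. 0 \<le> t \<Longrightarrow> 0 \<le> w t \<and> w t powr q \<le> m"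
    "\<And>t. 0 \<le> t \<Longrightarrow> (y has_real_derivative w t powr q) (at t within {0..})"
    "\<And>t. 0 \<le> t \<Longrightarrow> (w has_real_derivative F (t, y t, w t powr q) * y t powr (-\<beta>)) (at t within {0..})"
proof -
  define H where "H t = F (t, b t, \<xi>)" for t
  define cu where "cu t u = max 1 (min (b t) u)" for t u :: real
  define cs where "cs v = min \<xi> (max 0 v powr q)" for v :: real
  define G where "G t u v = F (t, cu t u, cs v) * max 1 u powr (-\<beta>)" for t u v
  define f where "f = (\<lambda>(t, u, v). (cs v, G t u v))"
  have b1: "1 \<le> b t" if "0 \<le> t" for t
    using b[OF that] m that by (smt (verit) mult_nonneg_nonneg)
  have cs: "0 \<le> cs v" "cs v \<le> \<xi>" for v using m by (auto simp: cs_def)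
  have cu: "1 \<le> cu t u" "cu t u \<le> b t" if "0 \<le> t" for t u using b1[OF that] by (auto simp: cu_def)
  have H0: "0 \<le> H t" if "0 \<le> t" for t using F0 b1[OF that] that m by (simp add: H_def)
  have G0: "0 \<le> G t u v" if "0 \<le> t" for t u v
    using cu[OF that, of u] cs[of v] that F0 by (simp add: G_def)
  \<comment> \<open>The weight has base at least 1 and a nonpositive exponent, so it is at most 1;
    the clamped arguments of \<open>F\<close> lie where its value at the upper corner
    dominates.\<close>
  have GH: "G t u v \<le> H t" if "0 \<le> t" for t u v
  proof -
    have "max 1 u powr (-\<beta>) \<le> 1" using powr_mono[of "-\<beta>" 0 "max 1 u"] \<beta> by (auto simp: max_def split: if_splits)
    moreover have "0 \<le> F (t, cu t u, cs v)" using cu[OF that, of u] cs[of v] that F0 by simp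
    ultimately have "G t u v \<le> F (t, cu t u, cs v)" unfolding G_def by (simp add: mult_left_le)
    also have "\<dots> \<le> H t" unfolding H_def using cu[OF that, of u] cs[of v] that by (intro le)
    finally show ?thesis .
  qed
  have Hc: "continuous_on {0..} H"
    unfolding H_def
    by (rule continuous_on_compose2[OF Fc]) (use b1 m in \<open>force intro!: continuous_intros bc\<close>)+
  have csc: "continuous_on UNIV cs"
    unfolding cs_def using q by (intro continuous_intros continuous_on_powr') auto
  have fc: "continuous_on ({0..} \<times> UNIV) f"
  proof -
    have fst: "continuous_on ({0..} \<times> UNIV) (\<lambda>z::real \<times> real \<times> real. b (fst z))"
      by (rule continuous_on_compose2[OF bc]) (auto intro: continuous_intros)
    have csv: "continuous_on ({0..} \<times> UNIV) (\<lambda>z::real \<times> real \<times> real. cs (snd (snd z)))"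
      by (rule continuous_on_compose2[OF csc]) (auto intro!: continuous_intros)
    have F: "continuous_on ({0..} \<times> UNIV) (\<lambda>z. F (fst z, cu (fst z) (fst (snd z)), cs (snd (snd z))))"
      by (rule continuous_on_compose2[OF Fc])
         (use cu cs in \<open>force simp: cu_def intro!: continuous_intros fst csv\<close>)+
    have pw: "continuous_on ({0..} \<times> UNIV) (\<lambda>z::real \<times> real \<times> real. max 1 (fst (snd z)) powr (-\<beta>))"
      by (intro continuous_intros) auto
    have f_eq: "f = (\<lambda>z. (cs (snd (snd z)), F (fst z, cu (fst z) (fst (snd z)), cs (snd (snd z)))
        * max 1 (fst (snd z)) powr (-\<beta>)))"
      by (auto simp: f_def G_def fun_eq_iff)
    show ?thesis unfolding f_eq by (intro continuous_on_Pair continuous_on_mult csv F pw)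
  qed
  have hc: "continuous_on {0..} (\<lambda>t. \<xi> + H t)" by (intro continuous_intros Hc)
  have fle: "norm (f (t, x)) \<le> \<xi> + H t" if "0 \<le> t" for t x
  proof -
    obtain u v where x: "x = (u, v)" by (cases x)
    have "norm (f (t, x)) \<le> norm (cs v) + norm (G t u v)"
      unfolding x f_def by (simp add: norm_Pair sqrt_sum_squares_le_sum_abs)
    then show ?thesis using cs[of v] G0[OF that, of u v] GH[OF that, of u v] by simp
  qed
  obtain x where x0: "x 0 = (1, 0)"
    and x: "\<And>t. 0 \<le> t \<Longrightarrow> (x has_vector_derivative f (t, x t)) (at t within {0..})"
    by (rule Peano_half_line[OF fc hc fle, where ?x0.0="(1, 0)"]) (assumption, rule that)
  define y where "y t = fst (x t)" for t
  define w where "w t = snd (x t)" for t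
  have fx: "f (t, x t) = (cs (w t), G t (y t) (w t))" for t
    by (simp add: f_def y_def w_def split: prod.split)
  have dy: "(y has_real_derivative cs (w t)) (at t within {0..})" if "0 \<le> t" for t
    using bounded_linear.has_vector_derivative[OF bounded_linear_fst x[OF that]]
    by (simp add: y_def[abs_def] fx has_real_derivative_iff_has_vector_derivative)
  have dw: "(w has_real_derivative G t (y t) (w t)) (at t within {0..})" if "0 \<le> t" for t
    using bounded_linear.has_vector_derivative[OF bounded_linear_snd x[OF that]]
    by (simp add: w_def[abs_def] fx has_real_derivative_iff_has_vector_derivative)
  have y0: "y 0 = 1" and w0: "w 0 = 0" using x0 by (simp_all add: y_def w_def)
  have iw: "((\<lambda>s. G s (y s) (w s)) has_integral w t) {0..t}" if "0 \<le> t" for t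
    using fundamental_theorem_of_calculus_half_line[OF dw that] w0 by simp
  have iy: "((\<lambda>s. cs (w s)) has_integral (y t - 1)) {0..t}" if "0 \<le> t" for t
    using fundamental_theorem_of_calculus_half_line[OF dy that] y0 by simp
  have w_nonneg: "0 \<le> w t" if "0 \<le> t" for t
    using has_integral_nonneg[OF iw[OF that]] G0 by auto
  \<comment> \<open>Integrating \<open>G \<le> H\<close> bounds the flux by the total integral of
    \<open>H\<close>, at most \<open>m powr (1 / q)\<close>. Raising to the power \<open>q\<close>
    then gives the slope bound \<open>m\<close>.\<close>
  have w_le: "w t \<le> m powr (1 / q)" if "0 \<le> t" for t
  proof -
    have H1: "H integrable_on {0..}" "integral {0..} H \<le> m powr (1 / q)"
      using set_borel_integral_eq_integral[OF int(1)] int(2) by (simp_all add: H_def[abs_def])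
    have H2: "H integrable_on {0..t}"
      by (intro integrable_continuous_real continuous_on_subset[OF Hc]) auto
    have "w t \<le> integral {0..t} H"
      using has_integral_le[OF iw[OF that] integrable_integral[OF H2]] GH by auto
    also have "\<dots> \<le> integral {0..} H"
      by (rule integral_subset_le[OF _ H2 H1(1)]) (use H0 in auto)
    finally show ?thesis using H1(2) by simp
  qed
  have wm: "w t powr q \<le> m" if "0 \<le> t" for t
    using powr_mono2[of q "w t" "m powr (1 / q)"] w_le[OF that] w_nonneg[OF that] q m
    by (simp add: powr_powr)
  \<comment> \<open>As \<open>m \<le> \<xi>\<close>, the slope bound keeps the cap in
    \<open>cs\<close> inactive.\<close>
  have cw: "cs (w t) = w t powr q" if "0 \<le> t" for t
    using wm[OF that] w_nonneg[OF that] m by (simp add: cs_def max_def)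
  have y1: "1 \<le> y t" if "0 \<le> t" for t
    using has_integral_nonneg[OF iy[OF that]] cs by auto
  \<comment> \<open>Integrating the slope bound keeps \<open>y\<close> below the line
    \<open>1 + m * t\<close>, hence below \<open>b t\<close>, so the clamp \<open>cu\<close> is
    inactive as well.\<close>
  have ym: "y t \<le> 1 + m * t" if "0 \<le> t" for t
    using has_integral_le[OF iy[OF that] has_integral_const_real[of m 0 t]] cw wm that
    by (auto simp: mult.commute)
  show thesis
  proof (rule that[of y w])
    fix t :: real assume t: "0 \<le> t"
    show "1 \<le> y t \<and> y t \<le> 1 + m * t" "0 \<le> w t \<and> w t powr q \<le> m"
      using y1 ym w_nonneg wm t by auto
    show "(y has_real_derivative w t powr q) (at t within {0..})"
      using dy[OF t] cw[OF t] by simp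
    have "G t (y t) (w t) = F (t, y t, w t powr q) * y t powr (-\<beta>)"
    proof -
      have "cu t (y t) = y t" using y1[OF t] ym[OF t] b[OF t] by (simp add: cu_def)
      then show ?thesis using cw[OF t] y1[OF t] by (simp add: G_def)
    qed
    then show "(w has_real_derivative F (t, y t, w t powr q) * y t powr (-\<beta>)) (at t within {0..})"
      using dw[OF t] by simp
  qed (rule y0 w0)+
qed

section \<open>The even entire solution and its growth\<close>

theorem proposition5p2:
  fixes p \<beta> l \<xi>1 \<xi>2 m :: real
    and \<phi> :: "real \<Rightarrow> real"
    and F :: "real \<times> real \<times> real \<Rightarrow> real"
  defines "\<phi> \<equiv> \<lambda>t. max l t"
    and "m \<equiv> min \<xi>1 \<xi>2"
  assumes "1 < p" and "p < 2"
    and "0 \<le> \<beta>" and "\<beta> \<le> p - 1"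
    and "0 \<le> l" and "1 \<le> \<xi>1" and "0 < \<xi>2"
    and F_holder: "\<exists>\<theta>. 0 < \<theta> \<and> \<theta> \<le> 1 \<and> locally_holder_on \<theta> ({0..} \<times> {0..} \<times> {0..}) F"
    and F_nonneg: "\<And>t u s. 0 \<le> t \<Longrightarrow> 0 \<le> u \<Longrightarrow> 0 \<le> s \<Longrightarrow> 0 \<le> F (t, u, s)"
    and F_mono_u: "\<And>t s. 0 \<le> t \<Longrightarrow> s \<in> {0..\<xi>2} \<Longrightarrow>
          mono_on {1..\<xi>1 * (1 + \<phi> t)} (\<lambda>u. F (t, u, s))"
    and F_mono_s: "\<And>t u. 0 \<le> t \<Longrightarrow> u \<in> {1..\<xi>1 * (1 + \<phi> t)} \<Longrightarrow>
          mono_on {0..\<xi>2} (\<lambda>s. F (t, u, s))"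
    and F_integrable: "set_integrable lborel {0..} (\<lambda>t. F (t, \<xi>1 * (1 + \<phi> t), \<xi>2))"
    and F_integral: "(LBINT t:{0..}. F (t, \<xi>1 * (1 + \<phi> t), \<xi>2)) \<le> m powr (p - 1)"
  shows "\<exists>u y y'.
      entire_solution p \<beta> F u \<and>
      (\<forall>x. 0 < u x) \<and> (\<forall>x. u (- x) = u x) \<and>
      (\<forall>x. u x = y \<bar>x\<bar>) \<and>
      (\<forall>t\<ge>0. (y has_real_derivative y' t) (at t within {0..})) \<and>
      (\<forall>t\<ge>0. 1 \<le> y t \<and> y t \<le> \<xi>1 * (1 + \<phi> t) \<and> 0 \<le> y' t \<and> y' t \<le> \<xi>2) \<and>
      y 0 = 1 \<and> y' 0 = 0 \<and>
      ((\<exists>r0\<ge>0. F (r0, 1, 0) \<noteq> 0) \<longrightarrow>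
        set_integrable lborel {0..} (\<lambda>t. F (t, y t, y' t) * y t powr (-\<beta>)) \<and>
        (let C = (LBINT t:{0..}. F (t, y t, y' t) * y t powr (-\<beta>)) powr (1 / (p - 1))
         in ((\<lambda>t. y t / \<phi> t) \<longlongrightarrow> C) at_top \<and> 0 < C \<and> C \<le> m))"
proof -
  define q where "q = 1 / (p - 1)"
  define b where "b t = \<xi>1 * (1 + \<phi> t)" for t
  \<comment> \<open>The exponent \<open>q\<close> inverts the flux: for nonnegative slopes,
    \<open>w = y' powr (p - 1)\<close> means \<open>y' = w powr q\<close>.\<close>
  have q: "0 < q" "1 / q = p - 1" using \<open>1 < p\<close> by (simp_all add: q_def)
  have m: "0 < m" "m \<le> \<xi>1" "m \<le> \<xi>2" using \<open>1 \<le> \<xi>1\<close> \<open>0 < \<xi>2\<close> by (auto simp: m_def)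
  have b: "1 + m * t \<le> b t" if "0 \<le> t" for t
  proof -
    have "m * t \<le> \<xi>1 * \<phi> t" using m that \<open>1 \<le> \<xi>1\<close> by (intro mult_mono) (auto simp: \<phi>_def)
    then show ?thesis using \<open>1 \<le> \<xi>1\<close> by (simp add: b_def algebra_simps)
  qed
  have b1: "1 \<le> b t" if "0 \<le> t" for t
    using b[OF that] m that by (smt (verit) mult_nonneg_nonneg)
  have bc: "continuous_on {0..} b" unfolding b_def \<phi>_def by (intro continuous_intros)
  have Fc: "continuous_on ({0..} \<times> {0..} \<times> {0..}) F"
    using F_holder locally_holder_on_imp_continuous_on[of "{0..} \<times> {0..} \<times> {0..}" _ F]
    by (auto intro!: closed_Times)
  have F_mono: "F (t, u, s) \<le> F (t, u', s')"
    if "0 \<le> t" "1 \<le> u" "u \<le> u'" "u' \<le> b t" "0 \<le> s" "s \<le> s'" "s' \<le> \<xi>2" for t u s u' s'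
  proof -
    have "F (t, u, s) \<le> F (t, u', s)"
      using F_mono_u[OF that(1), of s] that by (auto simp: mono_on_def b_def)
    also have "\<dots> \<le> F (t, u', s')"
      using F_mono_s[OF that(1), of u'] that by (auto simp: mono_on_def b_def)
    finally show ?thesis .
  qed
  have F_le: "F (t, u, s) \<le> F (t, b t, \<xi>2)"
    if "0 \<le> t" "1 \<le> u" "u \<le> b t" "0 \<le> s" "s \<le> \<xi>2" for t u s
    using that by (intro F_mono) auto
  have Hint: "set_integrable lborel {0..} (\<lambda>t. F (t, b t, \<xi>2))"
    using F_integrable by (simp add: b_def)
  have Hle: "(LBINT t:{0..}. F (t, b t, \<xi>2)) \<le> m powr (1 / q)"
    using F_integral by (simp add: b_def q(2))
  obtain y w where y0: "y 0 = 1" and w0: "w 0 = 0"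
    and y: "\<And>t. 0 \<le> t \<Longrightarrow> 1 \<le> y t \<and> y t \<le> 1 + m * t"
    and w: "\<And>t. 0 \<le> t \<Longrightarrow> 0 \<le> w t \<and> w t powr q \<le> m"
    and dy: "\<And>t. 0 \<le> t \<Longrightarrow> (y has_real_derivative w t powr q) (at t within {0..})"
    and dw: "\<And>t. 0 \<le> t \<Longrightarrow>
      (w has_real_derivative F (t, y t, w t powr q) * y t powr (-\<beta>)) (at t within {0..})"
    by (rule flux_system_solution
          [OF q(1) \<open>0 \<le> \<beta>\<close> m(1,3) Fc F_nonneg bc b F_le Hint Hle]) (assumption | rule that)+
  define y' where "y' t = w t powr q" for t
  define g where "g t = F (t, y t, y' t) * y t powr (-\<beta>)" for t
  have dy': "(y has_real_derivative y' t) (at t within {0..})" if "0 \<le> t" for t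
    using dy[OF that] by (simp add: y'_def)
  have dw': "(w has_real_derivative g t) (at t within {0..})" if "0 \<le> t" for t
    using dw[OF that] by (simp add: g_def y'_def)
  have y'0: "y' 0 = 0" by (simp add: y'_def w0)
  have y': "0 \<le> y' t" "y' t \<le> m" if "0 \<le> t" for t using w[OF that] by (auto simp: y'_def)
  have yb: "y t \<le> b t" if "0 \<le> t" for t using y[OF that] b[OF that] by linarith
  have yc: "continuous_on {0..} y" and wc: "continuous_on {0..} w"
    using dy dw by (auto intro!: DERIV_continuous_on)
  have y'c: "continuous_on {0..} y'"
    unfolding y'_def using q w by (intro continuous_on_powr' wc) auto
  have gc: "continuous_on {0..} g"
    unfolding g_def
  proof (intro continuous_on_mult continuous_on_compose2[OF Fc, of _ "\<lambda>t. (t, y t, y' t)"])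
    show "continuous_on {0..} (\<lambda>t. y t powr - \<beta>)"
      using y by (intro continuous_intros yc) force
    show "continuous_on {0..} (\<lambda>t. (t, y t, y' t))" by (intro continuous_intros yc y'c)
    show "(\<lambda>t. (t, y t, y' t)) ` {0..} \<subseteq> {0..} \<times> {0..} \<times> {0..}"
      using y y' by force
  qed
  have g0: "0 \<le> g t" if "0 \<le> t" for t
    using F_nonneg[of t "y t" "y' t"] y[OF that] y'[OF that] that by (simp add: g_def)

  \<comment> \<open>Extension from the half line to the whole line\<close>
  define u where "u x = y \<bar>x\<bar>" for x
  \<comment> \<open>Odd extensions of flux and slope. The test is written \<open>- x \<le> 0\<close>
    to fit the form of \<open>continuous_on_cases_le\<close>, applied with the function
    \<open>- x\<close> and threshold 0.\<close>
  define v where "v x = (if - x \<le> 0 then w x else - w (- x))" for x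
  define u' where "u' x = (if - x \<le> 0 then y' x else - y' (- x))" for x
  have du: "(u has_real_derivative u' x) (at x)" for x
    using has_real_derivative_reflection[of y y' 1 u x] dy' y'0 by (auto simp: u_def u'_def)
  have dv: "(v has_real_derivative g \<bar>x\<bar>) (at x)" for x
  proof -
    have "v x = w x" if "0 \<le> x" for x using that by (simp add: v_def)
    moreover have "v x = - 1 * w (- x)" if "x \<le> 0" for x using that w0 by (auto simp: v_def)
    ultimately show ?thesis
      using has_real_derivative_reflection[of w g "-1" v x] dw' by (simp add: abs_if split: if_splits)
  qed
  have u'c: "continuous_on UNIV u'"
    unfolding u'_def
  proof (rule continuous_on_cases_le)
    show "continuous_on {t \<in> UNIV. - t \<le> 0} y'" by (rule continuous_on_subset[OF y'c]) auto
    show "continuous_on {t \<in> UNIV. 0 \<le> - t} (\<lambda>t. - y' (- t))"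
      by (intro continuous_intros continuous_on_compose2[OF y'c]) auto
  qed (auto intro: continuous_intros simp: y'0)
  have gac: "continuous_on UNIV (\<lambda>x. g \<bar>x\<bar>)"
    by (rule continuous_on_compose2[OF gc]) (auto intro: continuous_intros)
  have deriv_u: "deriv u x = u' x" for x by (rule DERIV_imp_deriv[OF du])
  \<comment> \<open>The exponents combine to \<open>q * (p - 1) = 1\<close>. Where
    \<open>w t = 0\<close> both sides vanish, by the convention that 0 to any power is 0.\<close>
  have flux_y': "y' t powr (p - 2) * y' t = w t" if "0 \<le> t" for t
  proof (cases "w t = 0")
    case False
    have "q * (p - 2) + q = 1" using \<open>1 < p\<close> by (simp add: q_def field_simps)
    then show ?thesis
      using w[OF that] False by (simp add: y'_def powr_powr powr_add[symmetric])
  qed (simp add: y'_def)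
  have flux: "p_flux p u = v"
  proof
    fix x
    show "p_flux p u x = v x"
      using flux_y'[of x] flux_y'[of "- x"] y'(1)[of x] y'(1)[of "- x"]
      by (auto simp: p_flux_def deriv_u u'_def v_def)
  qed
  have ent: "entire_solution p \<beta> F u"
    unfolding entire_solution_def flux C1_differentiable_on_def
  proof (intro conjI allI exI ballI)
    show "(u has_vector_derivative u' x) (at x)" "(v has_vector_derivative g \<bar>x\<bar>) (at x)" for x
      using du dv by (simp_all add: has_real_derivative_iff_has_vector_derivative)
    show "deriv v x = F (\<bar>x\<bar>, u x, \<bar>deriv u x\<bar>) * u x powr - \<beta>" for x
    proof -
      have "\<bar>u' x\<bar> = y' \<bar>x\<bar>" using y'(1)[of "\<bar>x\<bar>"] by (auto simp: u'_def abs_if split: if_splits)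
      then show ?thesis using DERIV_imp_deriv[OF dv[of x]] by (simp add: deriv_u u_def g_def)
    qed
  qed (fact u'c gac)+
  have u_pos: "\<forall>x. 0 < u x"
  proof
    show "0 < u x" for x using y[of "\<bar>x\<bar>"] by (simp add: u_def)
  qed

  \<comment> \<open>The asymptotic slope\<close>
  have asymp: "(\<exists>r0\<ge>0. F (r0, 1, 0) \<noteq> 0) \<longrightarrow>
      set_integrable lborel {0..} g \<and>
      (let C = (LBINT t:{0..}. g t) powr (1 / (p - 1))
       in ((\<lambda>t. y t / \<phi> t) \<longlongrightarrow> C) at_top \<and> 0 < C \<and> C \<le> m)"
  proof (intro impI, elim exE conjE)
    fix r0 assume r0: "0 \<le> r0" "F (r0, 1, 0) \<noteq> 0"
    define I where "I = (LBINT t:{0..}. g t)"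
    have g_le: "g t \<le> F (t, b t, \<xi>2)" if "0 \<le> t" for t
    proof -
      have "y t powr (-\<beta>) \<le> 1" using powr_mono[of "-\<beta>" 0 "y t"] y[OF that] \<open>0 \<le> \<beta>\<close> by auto
      moreover have "0 \<le> F (t, y t, y' t)"
        using F_nonneg[of t "y t" "y' t"] y[OF that] y'[OF that] that by simp
      ultimately have "g t \<le> F (t, y t, y' t)" unfolding g_def by (simp add: mult_left_le)
      also have "\<dots> \<le> F (t, b t, \<xi>2)"
        using y[OF that] y'[OF that] yb[OF that] m that by (intro F_mono) auto
      finally show ?thesis .
    qed
    have gint: "set_integrable lborel {0..} g"
    proof (rule set_integrable_bound[OF Hint])
      show "set_borel_measurable lborel {0..} g"
        using borel_measurable_continuous_on_indicator[OF _ gc]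
        by (simp add: set_borel_measurable_def)
    qed (use g0 in \<open>auto intro!: AE_I2 intro: order_trans[OF g_le abs_ge_self]\<close>)
    have w_hi: "(g has_integral w t) {0..t}" if "0 \<le> t" for t
      using fundamental_theorem_of_calculus_half_line[OF dw' that] w0 by simp
    have w_int: "w t = (LBINT s:{0..t}. g s)" if "0 \<le> t" for t
    proof -
      have "set_integrable lborel {0..t} g"
        by (rule set_integrable_subset[OF gint]) auto
      then show ?thesis
        using w_hi[OF that] by (simp add: set_borel_integral_eq_integral(2) integral_unique)
    qed
    have I_hi: "(g has_integral I) {0..}"
      unfolding I_def set_borel_integral_eq_integral(2)[OF gint]
      by (intro integrable_integral set_borel_integral_eq_integral(1)[OF gint])
    have w_le: "w t \<le> I" if "0 \<le> t" for t
      by (rule has_integral_subset_le[OF _ w_hi[OF that] I_hi]) (use g0 in auto)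
    have w_lim: "(w \<longlongrightarrow> I) at_top"
    proof (rule Lim_transform_eventually)
      show "((\<lambda>t. LBINT s:{0..t}. g s) \<longlongrightarrow> I) at_top"
        unfolding I_def by (rule tendsto_set_lebesgue_integral_at_top[OF _ gint]) simp
      show "\<forall>\<^sub>F t in at_top. (LBINT s:{0..t}. g s) = w t"
        using eventually_ge_at_top[of 0] by eventually_elim (simp add: w_int)
    qed
    \<comment> \<open>A zero total would force the nonnegative flux to vanish identically and hence
      \<open>g r0 = 0\<close>, while monotonicity lifts the positive value
      \<open>F (r0, 1, 0)\<close> to the solution. Working with \<open>v\<close> on the whole line
      keeps the derivative two-sided even at \<open>r0 = 0\<close>.\<close>
    have "I \<noteq> 0"
    proof
      assume "I = 0"
      then have "w t = 0" if "0 \<le> t" for t using w_le[OF that] w[OF that] by auto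
      then have "v = (\<lambda>_. 0)" by (auto simp: v_def)
      then have "g r0 = 0" using DERIV_unique[OF dv[of r0]] DERIV_const r0(1) by fastforce
      moreover have "0 < F (r0, y r0, y' r0)"
      proof -
        have "0 < F (r0, 1, 0)" using F_nonneg[of r0 1 0] r0 by simp
        also have "\<dots> \<le> F (r0, y r0, y' r0)"
          using y[OF r0(1)] y'[OF r0(1)] yb[OF r0(1)] m r0(1) by (intro F_mono) auto
        finally show ?thesis .
      qed
      ultimately show False using y[OF r0(1)] by (auto simp: g_def)
    qed
    moreover have "0 \<le> I" using w_le[of 0] w0 by simp
    ultimately have I: "0 < I" by simp
    have I_le: "I \<le> m powr (p - 1)"
    proof -
      have "I \<le> (LBINT t:{0..}. F (t, b t, \<xi>2))"
        unfolding I_def by (rule set_integral_mono[OF gint Hint]) (use g_le in auto)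
      then show ?thesis using Hle q(2) by simp
    qed
    have "I powr q \<le> (m powr (p - 1)) powr q" using I I_le q by (intro powr_mono2) auto
    also have "\<dots> = m" using m \<open>1 < p\<close> by (simp add: powr_powr q_def)
    finally have Cm: "I powr q \<le> m" .
    \<comment> \<open>This form of l'Hospital's rule asks only the denominator to diverge, so no
      limit of \<open>y\<close> is needed. The slope converges because powers are continuous at the
      positive number \<open>I\<close>.\<close>
    have "((\<lambda>t. y t / t) \<longlongrightarrow> I powr q) at_top"
    proof (rule lhospital_at_top_at_top)
      show "\<forall>\<^sub>F t in at_top. (y has_real_derivative y' t) (at t)"
        using eventually_gt_at_top[of 0]
      proof eventually_elim
        case (elim t)
        then have "at t within {0..} = at t" by (intro at_within_interior) auto
        with dy'[of t] elim show ?case by simp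
      qed
      show "((\<lambda>t. y' t / 1) \<longlongrightarrow> I powr q) at_top"
        unfolding y'_def using I by (auto intro!: tendsto_powr w_lim)
    qed (auto intro: filterlim_ident)
    \<comment> \<open>From \<open>t = l\<close> onwards \<open>\<phi> t\<close> equals
      \<open>t\<close>.\<close>
    then have "((\<lambda>t. y t / \<phi> t) \<longlongrightarrow> I powr q) at_top"
      by (rule Lim_transform_eventually)
         (use eventually_ge_at_top[of l] in eventually_elim, simp add: \<phi>_def)
    then show "set_integrable lborel {0..} g \<and>
        (let C = (LBINT t:{0..}. g t) powr (1 / (p - 1))
         in ((\<lambda>t. y t / \<phi> t) \<longlongrightarrow> C) at_top \<and> 0 < C \<and> C \<le> m)"
      using gint Cm I by (simp add: I_def[symmetric] q_def[symmetric])
  qed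
  have dy_all: "\<forall>t\<ge>0. (y has_real_derivative y' t) (at t within {0..})" using dy' by simp
  have bounds: "\<forall>t\<ge>0. 1 \<le> y t \<and> y t \<le> \<xi>1 * (1 + \<phi> t) \<and> 0 \<le> y' t \<and> y' t \<le> \<xi>2"
    using y yb y' m by (force simp: b_def)
  have u_even: "\<forall>x. u (- x) = u x" "\<forall>x. u x = y \<bar>x\<bar>" by (simp_all add: u_def)
  show ?thesis
    by (rule exI[of _ u], rule exI[of _ y], rule exI[of _ y'])
       (fact ent u_pos u_even dy_all bounds y0 y'0 asymp[unfolded g_def] | rule conjI)+
qed

end
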